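(* Let $s\in\mathbb{N}$ and let $\boldsymbol{p}(n) = (p^{(1)}(n), p^{(2)}(n), \dots, p^{(s)}(n))$, where all $p^{(i)}(n)$, $1\le i \leq s$, are real polynomials with the property that for each point $\boldsymbol{h} \in \mathbb{Z}^s$, $\boldsymbol{h} \neq 0$, the polynomial $\langle \boldsymbol{h}, \boldsymbol{p}(n) \rangle$ (in the variable $n$) has at least one non-constant term with irrational coefficient. Then the sequence $(\{\boldsymbol{p}(n)\})_{n\ge 1}$ in $[0,1)^s$ does not have any $s$-dimensional S-NBRS.
   Context: $\mathbb{N}=\{1,2,\dots\}$; $\{x\}$ is the fractional part of a real $x$, and $\{(x^{(1)},\dots,x^{(s)})\}=(\{x^{(1)}\},\dots,\{x^{(s)}\})$; $\langle\cdot,\cdot\rangle$ is the standard inner product. Let $(\boldsymbol{x}_n)_{n\ge1}$ be a sequence in $[0,1)^s$. A nonempty box $[\boldsymbol{a},\boldsymbol{b})=\prod_{i=1}^s[a^{(i)},b^{(i)})\subset[0,1)^s$ (with $a^{(i)}<b^{(i)}$ for all $i$, and $[\boldsymbol a,\boldsymbol b)\neq[0,1)^s$) is called a strongly non-bounded remainder set (S-NBRS) for the sequence if for all $K\in\mathbb{N}$ there are $K$ successive elements of $(\boldsymbol{x}_n)_{n\geq 1}$ which all are contained in $[\boldsymbol{a},\boldsymbol{b})$ or which all are not contained in $[\boldsymbol{a},\boldsymbol{b})$. *)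

theory Defs
  imports "HOL-Analysis.Analysis" "HOL-Computational_Algebra.Polynomial"
begin

definition half_open_box :: "real ^ 's \<Rightarrow> real ^ 's \<Rightarrow> (real ^ 's) set" where
  "half_open_box a b = {x. \<forall>i. a $ i \<le> x $ i \<and> x $ i < b $ i}"

definition unit_cube :: "(real ^ 's) set" where
  "unit_cube = half_open_box (\<chi> i. 0) (\<chi> i. 1)"

definition frac_vec :: "real ^ 's \<Rightarrow> real ^ 's" where
  "frac_vec x = (\<chi> i. frac (x $ i))"

lemma frac_vec_in_unit_cube: "frac_vec x \<in> unit_cube"
  by (simp add: frac_vec_def unit_cube_def half_open_box_def frac_lt_1)

text \<open>Sequences are functions on \<^typ>\<open>nat\<close> of which only the values at positive
  indices matter, so the value at 0 is ignored.\<close>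

definition S_NBRS :: "(nat \<Rightarrow> real ^ 's) \<Rightarrow> real ^ 's \<Rightarrow> real ^ 's \<Rightarrow> bool" where
  "S_NBRS x a b \<longleftrightarrow>
     (\<forall>i. a $ i < b $ i) \<and>
     half_open_box a b \<subseteq> unit_cube \<and>
     half_open_box a b \<noteq> unit_cube \<and>
     (\<forall>K\<ge>1. \<exists>n\<ge>1.
        (\<forall>j<K. x (n + j) \<in> half_open_box a b) \<or>
        (\<forall>j<K. x (n + j) \<notin> half_open_box a b))"

text \<open>The polynomial \<open>\<langle>h, p(n)\<rangle>\<close> in the variable \<open>n\<close>, and the value \<open>p(n)\<close>.\<close>

definition inner_poly :: "int ^ 's \<Rightarrow> real poly ^ 's \<Rightarrow> real poly" where
  "inner_poly h p = (\<Sum>i\<in>UNIV. smult (of_int (h $ i)) (p $ i))"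

definition eval_poly_vec :: "real poly ^ 's \<Rightarrow> real \<Rightarrow> real ^ 's" where
  "eval_poly_vec p t = (\<chi> i. poly (p $ i) t)"

lemma poly_inner_poly:
  "poly (inner_poly h p) t = (\<chi> i. real_of_int (h $ i)) \<bullet> eval_poly_vec p t"
  by (simp add: inner_poly_def eval_poly_vec_def inner_vec_def poly_sum)

end

theory Submission
  imports Defs
begin

text \<open>
  The sequence \<open>{p(n)}\<close> visits every nondegenerate box inside \<open>[0,1]^s\<close> with bounded gaps: for each
  such box there is a \<open>K\<close> such that any \<open>K\<close> successive terms include one in the box.  A strongly
  non-bounded remainder set \<open>B\<close> is such a box, and since \<open>B\<close> is not the whole cube, its complement
  in the cube contains another one.  So among sufficiently many successive terms there is always one
  in \<open>B\<close> and one outside \<open>B\<close>, which contradicts the defining property of \<open>B\<close>.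

  Bounded gaps follow from Weyl's theorem in a form that is uniform in the position of the window:
  for \<open>h \<noteq> 0\<close> the averages of \<open>exp(2 \<pi> i \<langle>h, p(n)\<rangle>)\<close> over \<open>N\<close> successive integers tend to 0 as
  \<open>N\<close> grows, uniformly in the starting point (\<open>Weyl_uniform\<close>).  This is shown by induction on the
  largest index \<open>k\<close> of an irrational coefficient.  For \<open>k \<ge> 2\<close>, van der Corput's inequality, whose
  constants do not depend on the window, reduces the claim to the differences \<open>f(n + d) - f(n)\<close>,
  whose largest such index is \<open>k - 1\<close>.  For \<open>k = 1\<close>, the coefficients of degree at least 2 are
  rational, and translation by a common denominator \<open>D\<close> multiplies the exponential by a constant
  \<open>\<omega> \<noteq> 1\<close>; this keeps all window sums bounded.

  To pass from exponentials to a box with centre \<open>c\<close>, consider the nonnegative trigonometric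
  polynomial given by the product over \<open>i\<close> of \<open>((1 + cos(2 \<pi> (x_i - c_i))) / 2)^m\<close>.  Its mean value is
  a power of \<open>binom(2m, m) / 4^m\<close> and decays only polynomially in \<open>m\<close>, whereas outside the box it is
  at most \<open>\<rho>^m\<close> for some \<open>\<rho> < 1\<close>.  For a suitable \<open>m\<close> a long window that misses the box would
  have an average below the mean value, which is impossible.
\<close>

section \<open>Means over windows, uniformly in the position of the window\<close>

text \<open>
  The quantifier over the starting point \<open>n\<close> stands inside the limit.  Convergence of the averages
  over initial segments alone would not bound the gaps between visits to a box.
\<close>
definition has_uniform_mean :: "(nat \<Rightarrow> complex) \<Rightarrow> complex \<Rightarrow> bool" where
  "has_uniform_mean u c \<longleftrightarrow>
     (\<forall>\<epsilon>>0. \<forall>\<^sub>F N in sequentially. \<forall>n. norm ((\<Sum>j<N. u (n + j)) - of_nat N * c) \<le> \<epsilon> * real N)"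

lemma has_uniform_mean_const: "has_uniform_mean (\<lambda>n. c) c"
  by (simp add: has_uniform_mean_def)

lemma has_uniform_mean_mult_left:
  assumes "has_uniform_mean u c"
  shows "has_uniform_mean (\<lambda>n. a * u n) (a * c)"
  unfolding has_uniform_mean_def
proof (intro allI impI)
  fix \<epsilon> :: real assume "\<epsilon> > 0"
  define \<delta> where "\<delta> = \<epsilon> / (norm a + 1)"
  have "\<delta> > 0" using \<open>\<epsilon> > 0\<close> by (simp add: \<delta>_def add_nonneg_pos)
  have le: "norm a * \<delta> \<le> \<epsilon>"
    using \<open>\<epsilon> > 0\<close> by (simp add: \<delta>_def divide_simps add_nonneg_pos)
  from assms \<open>\<delta> > 0\<close> have "\<forall>\<^sub>F N in sequentially. \<forall>n. norm ((\<Sum>j<N. u (n + j)) - of_nat N * c) \<le> \<delta> * real N"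
    by (simp add: has_uniform_mean_def)
  then show "\<forall>\<^sub>F N in sequentially. \<forall>n. norm ((\<Sum>j<N. a * u (n + j)) - of_nat N * (a * c)) \<le> \<epsilon> * real N"
  proof eventually_elim
    case (elim N)
    show ?case
    proof
      fix n
      have "(\<Sum>j<N. a * u (n + j)) - of_nat N * (a * c) = a * ((\<Sum>j<N. u (n + j)) - of_nat N * c)"
        by (simp add: sum_distrib_left algebra_simps)
      then have "norm ((\<Sum>j<N. a * u (n + j)) - of_nat N * (a * c))
          = norm a * norm ((\<Sum>j<N. u (n + j)) - of_nat N * c)"
        by (simp add: norm_mult)
      also have "\<dots> \<le> norm a * (\<delta> * real N)"
        using elim by (simp add: mult_left_mono)
      also have "\<dots> \<le> \<epsilon> * real N"
        using le by (simp add: mult_right_mono flip: mult.assoc)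
      finally show "norm ((\<Sum>j<N. a * u (n + j)) - of_nat N * (a * c)) \<le> \<epsilon> * real N" .
    qed
  qed
qed

lemma has_uniform_mean_add:
  assumes "has_uniform_mean u c" "has_uniform_mean v d"
  shows "has_uniform_mean (\<lambda>n. u n + v n) (c + d)"
  unfolding has_uniform_mean_def
proof (intro allI impI)
  fix \<epsilon> :: real assume "\<epsilon> > 0"
  then have "\<epsilon> / 2 > 0" by simp
  have "\<forall>\<^sub>F N in sequentially. \<forall>n. norm ((\<Sum>j<N. u (n + j)) - of_nat N * c) \<le> \<epsilon> / 2 * real N"
    and "\<forall>\<^sub>F N in sequentially. \<forall>n. norm ((\<Sum>j<N. v (n + j)) - of_nat N * d) \<le> \<epsilon> / 2 * real N"
    using assms \<open>\<epsilon> / 2 > 0\<close> unfolding has_uniform_mean_def by blast+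
  then show "\<forall>\<^sub>F N in sequentially. \<forall>n. norm ((\<Sum>j<N. u (n + j) + v (n + j)) - of_nat N * (c + d)) \<le> \<epsilon> * real N"
  proof eventually_elim
    case (elim N)
    show ?case
    proof
      fix n
      have eq: "(\<Sum>j<N. u (n + j) + v (n + j)) - of_nat N * (c + d) =
          ((\<Sum>j<N. u (n + j)) - of_nat N * c) + ((\<Sum>j<N. v (n + j)) - of_nat N * d)"
        by (simp add: sum.distrib algebra_simps)
      show "norm ((\<Sum>j<N. u (n + j) + v (n + j)) - of_nat N * (c + d)) \<le> \<epsilon> * real N"
        unfolding eq using elim(1)[rule_format, of n] elim(2)[rule_format, of n]
        by (intro norm_triangle_le) (simp add: field_simps)
    qed
  qed
qed

lemma has_uniform_mean_sum:
  assumes "finite I" "\<And>i. i \<in> I \<Longrightarrow> has_uniform_mean (u i) (c i)"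
  shows "has_uniform_mean (\<lambda>n. \<Sum>i\<in>I. u i n) (\<Sum>i\<in>I. c i)"
  using assms
  by (induction rule: finite_induct) (auto intro: has_uniform_mean_add has_uniform_mean_const)

text \<open>
  Moving a window by one step exchanges one term at either end.
\<close>

lemma norm_window_sum_shift_le:
  fixes u :: "nat \<Rightarrow> complex"
  assumes "\<And>n. norm (u n) \<le> 1"
  shows "norm ((\<Sum>j<N. u (n + j + h)) - (\<Sum>j<N. u (n + j))) \<le> 2 * real h"
proof (induction h)
  case (Suc h)
  have "(\<Sum>j<N. u (n + j + Suc h)) - (\<Sum>j<N. u (n + j + h)) = u (n + N + h) - u (n + h)"
    using sum_lessThan_telescope[of "\<lambda>j. u (n + j + h)" N] by (simp add: sum_subtractf)
  moreover have "norm (u (n + N + h) - u (n + h)) \<le> 2"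
    using norm_triangle_ineq4[of "u (n + N + h)" "u (n + h)"] assms[of "n + N + h"] assms[of "n + h"]
    by linarith
  ultimately have "norm ((\<Sum>j<N. u (n + j + Suc h)) - (\<Sum>j<N. u (n + j + h))) \<le> 2" by simp
  with Suc.IH show ?case
    using norm_triangle_ineq[of "(\<Sum>j<N. u (n + j + Suc h)) - (\<Sum>j<N. u (n + j + h))"
        "(\<Sum>j<N. u (n + j + h)) - (\<Sum>j<N. u (n + j))"] by simp
qed simp

section \<open>Van der Corput's inequality\<close>

text \<open>
  Up to a boundary error, a window sum equals its average over the shifts by \<open>0, \<dots>, H - 1\<close>.  By
  Cauchy--Schwarz the square of this average is controlled by correlations: the \<open>H\<close> diagonal pairs of
  shifts contribute at most \<open>N\<close> each, all other pairs at most \<open>\<delta> N\<close>.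
\<close>

lemma van_der_Corput_window_bound:
  fixes u :: "nat \<Rightarrow> complex"
  assumes bd: "\<And>n. norm (u n) \<le> 1"
    and corr: "\<And>d m. 1 \<le> d \<Longrightarrow> d < H \<Longrightarrow> norm (\<Sum>j<N. u (m + j + d) * cnj (u (m + j))) \<le> \<delta> * real N"
    and "\<delta> \<ge> 0"
  shows "real H * norm (\<Sum>j<N. u (n + j)) \<le> 2 * (real H)\<^sup>2 + real N * sqrt (real H + (real H)\<^sup>2 * \<delta>)"
proof -
  define S where "S = (\<Sum>j<N. u (n + j))"
  define W where "W j = (\<Sum>h<H. u (n + j + h))" for j
  define T where "T = (\<Sum>j<N. W j)"
  have T: "T = (\<Sum>h<H. \<Sum>j<N. u (n + j + h))"
    unfolding T_def W_def by (rule sum.swap)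
  have "norm (T - of_nat H * S) = norm (\<Sum>h<H. (\<Sum>j<N. u (n + j + h)) - S)"
    by (simp add: T sum_subtractf)
  also have "\<dots> \<le> (\<Sum>h<H. 2 * real h)"
    unfolding S_def by (intro sum_norm_le norm_window_sum_shift_le bd)
  also have "\<dots> \<le> (\<Sum>h<H. 2 * real H)" by (intro sum_mono) auto
  also have "\<dots> = 2 * (real H)\<^sup>2" by (simp add: power2_eq_square)
  finally have TS: "norm (T - of_nat H * S) \<le> 2 * (real H)\<^sup>2" .

  have corr_le: "norm (\<Sum>j<N. u (n + j + h) * cnj (u (n + j + k))) \<le> (if h = k then real N else 0) + \<delta> * real N"
    if "h < H" "k < H" for h k
  proof (cases h k rule: linorder_cases)
    case less
    have eq: "(\<Sum>j<N. u (n + j + h) * cnj (u (n + j + k)))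
        = cnj (\<Sum>j<N. u ((n + h) + j + (k - h)) * cnj (u ((n + h) + j)))"
      using less by (simp add: mult.commute add_ac)
    have "norm (\<Sum>j<N. u (n + j + h) * cnj (u (n + j + k))) \<le> \<delta> * real N"
      unfolding eq complex_mod_cnj using less that by (intro corr) auto
    then show ?thesis using less by simp
  next
    case equal
    have "norm (u (n + j + h) * cnj (u (n + j + k))) \<le> 1" for j
      using bd[of "n + j + h"] equal by (simp add: norm_mult mult_le_one)
    then have "norm (\<Sum>j<N. u (n + j + h) * cnj (u (n + j + k))) \<le> (\<Sum>j<N. 1)"
      by (intro sum_norm_le) auto
    then show ?thesis using equal \<open>\<delta> \<ge> 0\<close> by (simp add: add_increasing2)
  next
    case greater
    have eq: "(\<Sum>j<N. u (n + j + h) * cnj (u (n + j + k)))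
        = (\<Sum>j<N. u ((n + k) + j + (h - k)) * cnj (u ((n + k) + j)))"
      using greater by (simp add: add_ac)
    have "norm (\<Sum>j<N. u (n + j + h) * cnj (u (n + j + k))) \<le> \<delta> * real N"
      unfolding eq using greater that by (intro corr) auto
    then show ?thesis using greater by simp
  qed
  have "complex_of_real (\<Sum>j<N. (norm (W j))\<^sup>2) = (\<Sum>j<N. W j * cnj (W j))"
    by (simp add: complex_norm_square[symmetric])
  also have "\<dots> = (\<Sum>j<N. \<Sum>h<H. \<Sum>k<H. u (n + j + h) * cnj (u (n + j + k)))"
    by (simp add: W_def sum_product)
  also have "\<dots> = (\<Sum>h<H. \<Sum>j<N. \<Sum>k<H. u (n + j + h) * cnj (u (n + j + k)))"
    by (rule sum.swap)
  also have "\<dots> = (\<Sum>h<H. \<Sum>k<H. \<Sum>j<N. u (n + j + h) * cnj (u (n + j + k)))"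
    by (intro sum.cong refl sum.swap)
  finally have "norm (complex_of_real (\<Sum>j<N. (norm (W j))\<^sup>2))
      = norm (\<Sum>h<H. \<Sum>k<H. \<Sum>j<N. u (n + j + h) * cnj (u (n + j + k)))" by simp
  also have "\<dots> \<le> (\<Sum>h<H. \<Sum>k<H. (if h = k then real N else 0) + \<delta> * real N)"
    by (intro sum_norm_le corr_le) auto
  also have "\<dots> = real N * (real H + (real H)\<^sup>2 * \<delta>)"
    by (simp add: sum.distrib power2_eq_square algebra_simps)
  finally have W2: "(\<Sum>j<N. (norm (W j))\<^sup>2) \<le> real N * (real H + (real H)\<^sup>2 * \<delta>)"
    by (simp only: norm_of_real abs_of_nonneg sum_nonneg zero_le_power2)

  have "(norm T)\<^sup>2 \<le> (\<Sum>j<N. norm (W j))\<^sup>2"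
    unfolding T_def by (intro power_mono norm_sum) auto
  also have "\<dots> \<le> (\<Sum>j<N. (norm (W j))\<^sup>2) * real N"
    using sum_squared_le_sum_of_squares[of "\<lambda>j. norm (W j)" "{..<N}"] by simp
  also have "\<dots> \<le> (real N)\<^sup>2 * (real H + (real H)\<^sup>2 * \<delta>)"
    using mult_right_mono[OF W2, of "real N"] by (simp add: power2_eq_square mult_ac)
  finally have "norm T \<le> real N * sqrt (real H + (real H)\<^sup>2 * \<delta>)"
    using real_le_rsqrt by (fastforce simp: real_sqrt_mult)
  moreover have "real H * norm S \<le> norm T + norm (T - of_nat H * S)"
    using norm_triangle_ineq4[of T "T - of_nat H * S"] by (simp add: norm_mult)
  ultimately show ?thesis using TS by (simp add: S_def)
qed

text \<open>
  Only finitely many correlations enter once \<open>H\<close> is chosen, so one threshold for \<open>N\<close>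
  serves all of them, and it does not depend on the starting point.
\<close>

lemma van_der_Corput_uniform:
  fixes u :: "nat \<Rightarrow> complex"
  assumes bd: "\<And>n. norm (u n) \<le> 1"
    and corr: "\<And>d. d \<ge> 1 \<Longrightarrow> has_uniform_mean (\<lambda>n. u (n + d) * cnj (u n)) 0"
  shows "has_uniform_mean u 0"
  unfolding has_uniform_mean_def
proof (intro allI impI)
  fix \<epsilon> :: real assume "\<epsilon> > 0"
  (* With 1/H < \<delta> and \<delta> = \<epsilon>^2/8 the main term of the window bound is at most H N \<epsilon>/2;
     the boundary term 2 H^2 is at most H N \<epsilon>/2 as soon as N \<ge> 4 H/\<epsilon>. *)
  define \<delta> where "\<delta> = \<epsilon>\<^sup>2 / 8"
  have "\<delta> > 0" using \<open>\<epsilon> > 0\<close> by (simp add: \<delta>_def)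
  obtain H :: nat where "H > 0" and H: "1 / real H < \<delta>"
    using reals_Archimedean[OF \<open>\<delta> > 0\<close>] by (metis inverse_eq_divide zero_less_Suc)
  have "real H + (real H)\<^sup>2 * \<delta> \<le> (real H * \<epsilon> / 2)\<^sup>2"
  proof -
    have "real H \<le> (real H)\<^sup>2 * \<delta>"
      using H \<open>H > 0\<close> by (simp add: power2_eq_square field_simps)
    then have "real H + (real H)\<^sup>2 * \<delta> \<le> 2 * ((real H)\<^sup>2 * \<delta>)" by linarith
    also have "\<dots> = (real H * \<epsilon> / 2)\<^sup>2" by (simp add: \<delta>_def power2_eq_square)
    finally show ?thesis .
  qed
  then have sqrt_le: "sqrt (real H + (real H)\<^sup>2 * \<delta>) \<le> real H * \<epsilon> / 2"
    using \<open>\<epsilon> > 0\<close> by (intro real_le_lsqrt) auto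
  have "\<forall>\<^sub>F N in sequentially. \<forall>d\<in>{1..<H}. \<forall>n. norm (\<Sum>j<N. u (n + j + d) * cnj (u (n + j))) \<le> \<delta> * real N"
    using corr \<open>\<delta> > 0\<close> by (intro eventually_ball_finite) (auto simp: has_uniform_mean_def)
  moreover have "\<forall>\<^sub>F N in sequentially. 4 * real H / \<epsilon> \<le> real N"
    using filterlim_real_sequentially by (simp add: filterlim_at_top)
  ultimately show "\<forall>\<^sub>F N in sequentially. \<forall>n. norm ((\<Sum>j<N. u (n + j)) - of_nat N * 0) \<le> \<epsilon> * real N"
  proof eventually_elim
    case (elim N)
    show ?case
    proof
      fix n
      have "real H * norm (\<Sum>j<N. u (n + j)) \<le> 2 * (real H)\<^sup>2 + real N * sqrt (real H + (real H)\<^sup>2 * \<delta>)"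
        using elim(1) \<open>\<delta> > 0\<close> by (intro van_der_Corput_window_bound bd) auto
      also have "\<dots> \<le> 2 * (real H)\<^sup>2 + real N * (real H * \<epsilon> / 2)"
        using sqrt_le by (intro add_left_mono mult_left_mono) auto
      also have "\<dots> = real H * (2 * real H + real N * \<epsilon> / 2)"
        by (simp add: power2_eq_square algebra_simps)
      finally have "norm (\<Sum>j<N. u (n + j)) \<le> 2 * real H + real N * \<epsilon> / 2"
        using \<open>H > 0\<close> by simp
      also have "\<dots> \<le> \<epsilon> * real N"
        using elim(2) \<open>\<epsilon> > 0\<close> by (simp add: field_simps)
      finally show "norm ((\<Sum>j<N. u (n + j)) - of_nat N * 0) \<le> \<epsilon> * real N" by simp
    qed
  qed
qed

text \<open>
  Moving a window by \<open>D\<close> multiplies its sum by \<open>\<omega>\<close> but changes it by at most \<open>2 D\<close>.  Hence all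
  window sums are bounded by \<open>2 D / \<bar>\<omega> - 1\<bar>\<close>, whatever their length.
\<close>

lemma has_uniform_mean_zero_if_quasiperiodic:
  fixes u :: "nat \<Rightarrow> complex"
  assumes bd: "\<And>n. norm (u n) \<le> 1"
    and rot: "\<And>n. u (n + D) = \<omega> * u n" and "\<omega> \<noteq> 1"
  shows "has_uniform_mean u 0"
  unfolding has_uniform_mean_def
proof (intro allI impI)
  fix \<epsilon> :: real assume "\<epsilon> > 0"
  have pos: "norm (\<omega> - 1) > 0" using \<open>\<omega> \<noteq> 1\<close> by simp
  have "\<forall>\<^sub>F N in sequentially. 2 * real D / norm (\<omega> - 1) / \<epsilon> \<le> real N"
    using filterlim_real_sequentially by (simp add: filterlim_at_top)
  then show "\<forall>\<^sub>F N in sequentially. \<forall>n. norm ((\<Sum>j<N. u (n + j)) - of_nat N * 0) \<le> \<epsilon> * real N"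
  proof eventually_elim
    case (elim N)
    show ?case
    proof
      fix n
      have "(\<Sum>j<N. u (n + j + D)) - (\<Sum>j<N. u (n + j)) = (\<omega> - 1) * (\<Sum>j<N. u (n + j))"
        by (simp only: rot) (simp add: sum_distrib_left sum_subtractf algebra_simps)
      then have "norm (\<omega> - 1) * norm (\<Sum>j<N. u (n + j)) \<le> 2 * real D"
        using norm_window_sum_shift_le[where u = u and N = N and n = n and h = D, OF bd] by (simp add: norm_mult)
      then have "norm (\<Sum>j<N. u (n + j)) \<le> 2 * real D / norm (\<omega> - 1)"
        using pos by (simp add: pos_le_divide_eq mult.commute)
      also have "\<dots> \<le> \<epsilon> * real N"
        using elim \<open>\<epsilon> > 0\<close> by (metis pos_divide_le_eq mult.commute)
      finally show "norm ((\<Sum>j<N. u (n + j)) - of_nat N * 0) \<le> \<epsilon> * real N" by simp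
    qed
  qed
qed

section \<open>Weyl's theorem for polynomials\<close>

lemma coeff_pcompose_shift:
  fixes f :: "real poly"
  shows "coeff (pcompose f [:d, 1:]) j = (\<Sum>i\<in>{j..degree f}. coeff f i * of_nat (i choose j) * d ^ (i - j))"
proof -
  have c: "coeff ([:d, 1:] ^ i) j = (if j \<le> i then of_nat (i choose j) * d ^ (i - j) else 0)" for i
    by (simp add: coeff_linear_poly_power coeff_eq_0 degree_linear_power)
  have m: "pcompose (monom a i) [:d, 1:] = smult a ([:d, 1:] ^ i)" for a :: real and i
    by (simp add: pcompose_altdef map_poly_monom poly_monom)
  have "pcompose f [:d, 1:] = pcompose (\<Sum>i\<le>degree f. monom (coeff f i) i) [:d, 1:]"
    by (simp only: poly_as_sum_of_monoms)
  also have "\<dots> = (\<Sum>i\<le>degree f. smult (coeff f i) ([:d, 1:] ^ i))"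
    by (simp only: pcompose_sum m)
  finally have "coeff (pcompose f [:d, 1:]) j
      = (\<Sum>i\<le>degree f. if i \<in> {j..degree f} then coeff f i * of_nat (i choose j) * d ^ (i - j) else 0)"
    by (auto simp: coeff_sum c intro!: sum.cong)
  also have "\<dots> = (\<Sum>i\<in>{j..degree f}. coeff f i * of_nat (i choose j) * d ^ (i - j))"
    by (subst sum.inter_restrict[symmetric]) (auto intro!: sum.cong)
  finally show ?thesis .
qed

lemma coeff_forward_difference:
  fixes f :: "real poly"
  shows "coeff (pcompose f [:d, 1:] - f) j = (\<Sum>i\<in>{j<..degree f}. coeff f i * of_nat (i choose j) * d ^ (i - j))"
proof (cases "j \<le> degree f")
  case True
  then have "{j..degree f} = insert j {j<..degree f}" by auto
  then show ?thesis by (simp add: coeff_pcompose_shift)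
next
  case False
  then show ?thesis by (simp add: coeff_pcompose_shift coeff_eq_0)
qed

text \<open>
  Differencing lowers the largest index of an irrational coefficient by exactly one: the new
  coefficient at \<open>k\<close> is \<open>(k + 1) d\<close> times the old one at \<open>k + 1\<close>, plus contributions of higher
  coefficients, which are rational.  The coefficients of \<open>f\<close> up to index \<open>k\<close>, about which nothing is
  known, have cancelled.
\<close>

lemma forward_difference_top_irrational_coeff:
  fixes f :: "real poly" and d :: nat
  assumes irr: "coeff f (Suc k) \<notin> \<rat>" and rat: "\<And>i. i > Suc k \<Longrightarrow> coeff f i \<in> \<rat>" and "d \<ge> 1"
  shows "coeff (pcompose f [:real d, 1:] - f) k \<notin> \<rat>"
    and "\<And>i. i > k \<Longrightarrow> coeff (pcompose f [:real d, 1:] - f) i \<in> \<rat>"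
proof -
  have "Suc k \<le> degree f" using irr by (metis Rats_0 le_degree)
  then have set: "{k<..degree f} = insert (Suc k) {Suc k<..degree f}" by auto
  define R where "R = (\<Sum>i\<in>{Suc k<..degree f}. coeff f i * of_nat (i choose k) * real d ^ (i - k))"
  have "R \<in> \<rat>" unfolding R_def by (intro Rats_sum Rats_mult Rats_power rat) auto
  have "coeff (pcompose f [:real d, 1:] - f) k = coeff f (Suc k) * of_nat (Suc k * d) + R"
    unfolding coeff_forward_difference set R_def by (simp add: algebra_simps)
  moreover have "coeff f (Suc k) * of_nat (Suc k * d) + R \<notin> \<rat>"
  proof
    assume "coeff f (Suc k) * of_nat (Suc k * d) + R \<in> \<rat>"
    then have "(coeff f (Suc k) * of_nat (Suc k * d) + R - R) / of_nat (Suc k * d) \<in> \<rat>"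
      using \<open>R \<in> \<rat>\<close> by (intro Rats_divide Rats_diff) auto
    moreover have "real (Suc k * d) \<noteq> 0" using \<open>d \<ge> 1\<close> by (simp del: of_nat_mult)
    ultimately show False using irr by (simp del: of_nat_mult)
  qed
  ultimately show "coeff (pcompose f [:real d, 1:] - f) k \<notin> \<rat>" by simp
  show "coeff (pcompose f [:real d, 1:] - f) i \<in> \<rat>" if "i > k" for i
    unfolding coeff_forward_difference using that
    by (intro Rats_sum Rats_mult Rats_power rat) auto
qed

lemma common_denominator:
  fixes A :: "real set"
  assumes "finite A" "A \<subseteq> \<rat>"
  obtains D :: nat where "D > 0" "\<And>x. x \<in> A \<Longrightarrow> x * real D \<in> \<int>"
proof -
  from assms have "\<exists>D::nat>0. \<forall>x\<in>A. x * real D \<in> \<int>"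
  proof (induction rule: finite_induct)
    case empty
    then show ?case by auto
  next
    case (insert y A)
    then obtain D :: nat where D: "D > 0" "\<forall>x\<in>A. x * real D \<in> \<int>" by auto
    from insert.prems have "y \<in> \<rat>" by simp
    then obtain a b where b: "b > 0" "y = of_int a / of_int b"
      by (rule Rats_cases') auto
    have "y * real (D * nat b) = of_int (a * int D)" using b by simp
    then have "y * real (D * nat b) \<in> \<int>" by (metis Ints_of_int)
    moreover have "x * real (D * nat b) \<in> \<int>" if "x \<in> A" for x
      using D(2) that Ints_mult[of "x * real D" "real (nat b)"] by (simp add: mult.assoc)
    ultimately show ?case using D(1) b(1) by (intro exI[of _ "D * nat b"]) auto
  qed
  then show ?thesis using that by blast
qed

lemma cis_2pi_ne_1:
  assumes "x \<notin> \<int>"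
  shows "cis (2 * pi * x) \<noteq> 1"
proof
  assume "cis (2 * pi * x) = 1"
  then have "cos (2 * pi * x) = 1" by (simp add: complex_eq_iff)
  then obtain m :: int where "2 * pi * x = of_int m * 2 * pi"
    by (auto simp: cos_one_2pi_int)
  then have "x = of_int m" by simp
  with assms show False by auto
qed

text \<open>
  The base case of the induction.  Differencing once more would leave an expression that is
  constant modulo 1, so van der Corput's inequality is of no use here; instead the exponential is
  quasiperiodic.
\<close>

lemma Weyl_uniform_linear:
  fixes f :: "real poly"
  assumes irr: "coeff f 1 \<notin> \<rat>" and rat: "\<And>i. i > 1 \<Longrightarrow> coeff f i \<in> \<rat>"
  shows "has_uniform_mean (\<lambda>n. cis (2 * pi * poly f (real n))) 0"
proof -
  have "degree f \<ge> 1" using irr by (metis Rats_0 le_degree)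
  (* D divides (n + D)^i - n^i, so every term of degree i > 1 changes by an integer
     when n is replaced by n + D. *)
  obtain D :: nat where "D > 0" and D: "\<And>x. x \<in> coeff f ` {1<..degree f} \<Longrightarrow> x * real D \<in> \<int>"
    by (rule common_denominator[of "coeff f ` {1<..degree f}"]) (use rat in auto)
  define \<alpha> where "\<alpha> = coeff f 1 * real D"
  have "\<alpha> \<notin> \<int>"
  proof
    assume "\<alpha> \<in> \<int>"
    then have "\<alpha> / real D \<in> \<rat>" using Ints_subset_Rats by (intro Rats_divide) auto
    with irr \<open>D > 0\<close> show False by (simp add: \<alpha>_def)
  qed
  have "poly f (real (n + D)) - poly f (real n) - \<alpha> \<in> \<int>" for n
  proof -
    have "poly f (real (n + D)) - poly f (real n) - \<alpha>
        = (\<Sum>i\<le>degree f. coeff f i * (real (n + D) ^ i - real n ^ i) - (if i = 1 then \<alpha> else 0))"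
      using \<open>degree f \<ge> 1\<close> by (simp add: poly_altdef sum_subtractf right_diff_distrib)
    also have "\<dots> \<in> \<int>"
    proof (rule Ints_sum)
      fix i assume "i \<in> {..degree f}"
      then consider "i = 0" | "i = 1" | "i \<in> {1<..degree f}" by force
      then show "coeff f i * (real (n + D) ^ i - real n ^ i) - (if i = 1 then \<alpha> else 0) \<in> \<int>"
      proof cases
        case 3
        have "real (n + D) ^ i - real n ^ i
            = real D * (\<Sum>j<i. real n ^ (i - Suc j) * real (n + D) ^ j)"
          by (simp add: power_diff_sumr2)
        then have "coeff f i * (real (n + D) ^ i - real n ^ i)
            = (coeff f i * real D) * (\<Sum>j<i. real n ^ (i - Suc j) * real (n + D) ^ j)" by simp
        also have "\<dots> \<in> \<int>" using D[OF imageI[OF 3]]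
          by (intro Ints_mult[of "coeff f i * real D"] Ints_sum) (auto intro!: Ints_mult Ints_power)
        finally show ?thesis using 3 by simp
      qed (simp_all add: \<alpha>_def)
    qed
    finally show ?thesis .
  qed
  note shift = this
  have "cis (2 * pi * poly f (real (n + D))) = cis (2 * pi * \<alpha>) * cis (2 * pi * poly f (real n))" for n
  proof -
    define z where "z = poly f (real (n + D)) - poly f (real n) - \<alpha>"
    have "2 * pi * poly f (real (n + D)) = 2 * pi * z + (2 * pi * \<alpha> + 2 * pi * poly f (real n))"
      by (simp add: z_def algebra_simps)
    moreover have "cis (2 * pi * z) = 1" using shift by (simp add: z_def)
    ultimately show ?thesis by (metis cis_mult mult_1)
  qed
  moreover have "cis (2 * pi * \<alpha>) \<noteq> 1" using \<open>\<alpha> \<notin> \<int>\<close> by (rule cis_2pi_ne_1)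
  ultimately show ?thesis
    by (intro has_uniform_mean_zero_if_quasiperiodic) auto
qed

text \<open>
  The correlations of \<open>exp(2 \<pi> i f(n))\<close> are the exponentials of the differences of \<open>f\<close>, so van der
  Corput's inequality carries the claim from index \<open>k\<close> to index \<open>k + 1\<close>.
\<close>

lemma Weyl_uniform:
  fixes f :: "real poly"
  assumes "k \<ge> 1" "coeff f k \<notin> \<rat>" "\<And>i. i > k \<Longrightarrow> coeff f i \<in> \<rat>"
  shows "has_uniform_mean (\<lambda>n. cis (2 * pi * poly f (real n))) 0"
  using assms
proof (induction k arbitrary: f rule: nat_induct_at_least)
  case base
  then show ?case by (intro Weyl_uniform_linear) auto
next
  case (Suc k)
  show ?case
  proof (rule van_der_Corput_uniform)
    fix d :: nat assume "d \<ge> 1"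
    define g where "g = pcompose f [:real d, 1:] - f"
    have "has_uniform_mean (\<lambda>n. cis (2 * pi * poly g (real n))) 0"
      unfolding g_def
      using forward_difference_top_irrational_coeff[of f k d] Suc.prems \<open>d \<ge> 1\<close>
      by (intro Suc.IH) auto
    moreover have "cis (2 * pi * poly f (real (n + d))) * cnj (cis (2 * pi * poly f (real n)))
        = cis (2 * pi * poly g (real n))" for n
      by (simp add: g_def poly_pcompose cis_cnj cis_mult algebra_simps)
    ultimately show "has_uniform_mean
        (\<lambda>n. cis (2 * pi * poly f (real (n + d))) * cnj (cis (2 * pi * poly f (real n)))) 0"
      by simp
  qed simp
qed

lemma cis_sum: "cis (\<Sum>i\<in>I. t i) = (\<Prod>i\<in>I. cis (t i))"
  by (induction I rule: infinite_finite_induct) (auto simp: cis_mult[symmetric])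

lemma Weyl_uniform_inner:
  fixes p :: "real poly ^ 's"
  assumes "\<exists>k\<ge>1. coeff (inner_poly h p) k \<notin> \<rat>"
  shows "has_uniform_mean
    (\<lambda>n. cis (2 * pi * (\<Sum>i\<in>UNIV. real_of_int (h $ i) * eval_poly_vec p (real n) $ i))) 0"
proof -
  define f where "f = inner_poly h p"
  define S where "S = {k. coeff f k \<notin> \<rat>}"
  have "k \<le> degree f" if "k \<in> S" for k
    using that by (intro le_degree) (auto simp: S_def)
  then have fin: "finite S" by (intro finite_subset[of S "{..degree f}"]) auto
  obtain k0 where k0: "k0 \<ge> 1" "k0 \<in> S" using assms by (auto simp: S_def f_def)
  define k where "k = Max S"
  have "k \<in> S" unfolding k_def using fin k0 by (intro Max_in) auto
  moreover have "k \<ge> 1" unfolding k_def using Max_ge[OF fin k0(2)] k0(1) by linarith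
  moreover have "coeff f i \<in> \<rat>" if "i > k" for i
    using that Max_ge[OF fin, of i] by (auto simp: k_def S_def)
  ultimately have "has_uniform_mean (\<lambda>n. cis (2 * pi * poly f (real n))) 0"
    by (intro Weyl_uniform) (auto simp: S_def)
  then show ?thesis
    by (simp add: f_def poly_inner_poly inner_vec_def)
qed

section \<open>A trigonometric polynomial concentrated in a box\<close>

text \<open>
  A nonnegative trigonometric polynomial of period 1 that equals 1 at the integers and, for large
  \<open>m\<close>, is small away from them.
\<close>

definition cos_bump :: "nat \<Rightarrow> real \<Rightarrow> real" where
  "cos_bump m t = ((1 + cos (2 * pi * t)) / 2) ^ m"

text \<open>
  Since \<open>(1 + cos(2 \<phi>)) / 2\<close> is the square of \<open>cos \<phi> = (exp(i \<phi>) + exp(-i \<phi>)) / 2\<close>, this is the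
  binomial theorem with exponent \<open>2 m\<close>.  The constant term sits at \<open>k = m\<close>.
\<close>

lemma cos_bump_expansion:
  "complex_of_real (cos_bump m t)
    = (\<Sum>k\<le>2 * m. of_real (real ((2 * m) choose k) / 4 ^ m) * cis (2 * pi * ((real k - real m) * t)))"
proof -
  define \<phi> where "\<phi> = pi * t"
  have "(1 + cos (2 * pi * t)) / 2 = (cos \<phi>)\<^sup>2"
    using cos_double_cos[of \<phi>] by (simp add: \<phi>_def mult.assoc)
  then have "complex_of_real (cos_bump m t) = (complex_of_real (cos \<phi>)) ^ (2 * m)"
    by (simp add: cos_bump_def power_mult)
  also have "complex_of_real (cos \<phi>) = (cis \<phi> + cis (- \<phi>)) / 2"
    by (simp add: complex_eq_iff)
  also have "((cis \<phi> + cis (- \<phi>)) / 2) ^ (2 * m) = (cis \<phi> + cis (- \<phi>)) ^ (2 * m) / 4 ^ m"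
    by (simp add: power_divide power_mult)
  also have "\<dots> = (\<Sum>k\<le>2 * m. of_nat ((2 * m) choose k) * cis \<phi> ^ k * cis (- \<phi>) ^ (2 * m - k) / 4 ^ m)"
    by (simp add: binomial_ring sum_divide_distrib)
  also have "\<dots> = (\<Sum>k\<le>2 * m. of_real (real ((2 * m) choose k) / 4 ^ m) * cis (2 * pi * ((real k - real m) * t)))"
  proof (rule sum.cong)
    fix k assume "k \<in> {..2 * m}"
    then have "real k * \<phi> + real (2 * m - k) * (- \<phi>) = 2 * pi * ((real k - real m) * t)"
      by (simp add: \<phi>_def of_nat_diff algebra_simps)
    then have "cis \<phi> ^ k * cis (- \<phi>) ^ (2 * m - k) = cis (2 * pi * ((real k - real m) * t))"
      by (simp only: Complex.DeMoivre cis_mult)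
    then show "of_nat ((2 * m) choose k) * cis \<phi> ^ k * cis (- \<phi>) ^ (2 * m - k) / 4 ^ m
        = complex_of_real (real ((2 * m) choose k) / 4 ^ m) * cis (2 * pi * ((real k - real m) * t))"
      by (simp add: mult.assoc)
  qed simp
  finally show ?thesis .
qed

text \<open>
  Multiplying out the product gives a finite combination of exponentials with integer
  frequency vectors \<open>h\<close>.  All of them have mean 0 except the one with \<open>h = 0\<close>, so the mean is
  the constant term of the product.
\<close>

lemma uniform_mean_cos_bump_product:
  fixes x :: "nat \<Rightarrow> real ^ 's" and c :: "real ^ 's"
  assumes Weyl: "\<And>h :: int ^ 's. h \<noteq> 0 \<Longrightarrow>
    has_uniform_mean (\<lambda>n. cis (2 * pi * (\<Sum>i\<in>UNIV. real_of_int (h $ i) * x n $ i))) 0"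
  shows "has_uniform_mean (\<lambda>n. of_real (\<Prod>i\<in>UNIV. cos_bump m (x n $ i - c $ i)))
    (of_real ((real ((2 * m) choose m) / 4 ^ m) ^ CARD('s)))"
proof -
  define \<beta> where "\<beta> k = real ((2 * m) choose k) / 4 ^ m" for k
  define G where "G = (PiE UNIV (\<lambda>_. {..2 * m}) :: ('s \<Rightarrow> nat) set)"
  define A where "A g = (\<Prod>i\<in>UNIV. complex_of_real (\<beta> (g i)) * cis (- (2 * pi * ((real (g i) - real m) * c $ i))))"
    for g :: "'s \<Rightarrow> nat"
  define e where "e g n = cis (2 * pi * (\<Sum>i\<in>UNIV. (real (g i) - real m) * x n $ i))"
    for g :: "'s \<Rightarrow> nat" and n
  have "finite G" unfolding G_def by (intro finite_PiE) auto
  have center: "(\<lambda>_. m) \<in> G" by (auto simp: G_def PiE_def)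
  have expand: "complex_of_real (\<Prod>i\<in>UNIV. cos_bump m (x n $ i - c $ i)) = (\<Sum>g\<in>G. A g * e g n)" for n
  proof -
    have "complex_of_real (\<Prod>i\<in>UNIV. cos_bump m (x n $ i - c $ i))
        = (\<Prod>i\<in>UNIV. \<Sum>k\<le>2 * m. of_real (\<beta> k) * cis (2 * pi * ((real k - real m) * (x n $ i - c $ i))))"
      by (simp only: of_real_prod cos_bump_expansion \<beta>_def)
    also have "\<dots> = (\<Sum>g\<in>G. \<Prod>i\<in>UNIV. of_real (\<beta> (g i)) * cis (2 * pi * ((real (g i) - real m) * (x n $ i - c $ i))))"
      unfolding G_def by (rule prod_sum_PiE) auto
    also have "\<dots> = (\<Sum>g\<in>G. A g * e g n)"
    proof (rule sum.cong)
      fix g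
      have "cis (2 * pi * ((real (g i) - real m) * (x n $ i - c $ i)))
          = cis (- (2 * pi * ((real (g i) - real m) * c $ i))) * cis (2 * pi * ((real (g i) - real m) * x n $ i))" for i
        by (simp add: cis_mult algebra_simps)
      then show "(\<Prod>i\<in>UNIV. of_real (\<beta> (g i)) * cis (2 * pi * ((real (g i) - real m) * (x n $ i - c $ i)))) = A g * e g n"
        by (simp add: A_def e_def sum_distrib_left cis_sum prod.distrib mult_ac)
    qed simp
    finally show ?thesis .
  qed
  (* The choice g of one summand from each factor has frequency vector g - m. *)
  have mean: "has_uniform_mean (e g) (if g = (\<lambda>_. m) then 1 else 0)" for g
  proof (cases "g = (\<lambda>_. m)")
    case True
    then show ?thesis using has_uniform_mean_const[of 1] by (simp add: e_def[abs_def])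
  next
    case False
    define h :: "int ^ 's" where "h = (\<chi> i. int (g i) - int m)"
    have "h \<noteq> 0" using False by (auto simp: h_def vec_eq_iff)
    then show ?thesis using Weyl[of h] False by (simp add: h_def e_def[abs_def])
  qed
  have "has_uniform_mean (\<lambda>n. \<Sum>g\<in>G. A g * e g n) (\<Sum>g\<in>G. A g * (if g = (\<lambda>_. m) then 1 else 0))"
    by (intro has_uniform_mean_sum has_uniform_mean_mult_left mean \<open>finite G\<close>)
  also have "(\<Sum>g\<in>G. A g * (if g = (\<lambda>_. m) then 1 else 0))
      = (\<Sum>g\<in>{\<lambda>_. m}. A g * (if g = (\<lambda>_. m) then 1 else 0))"
    by (rule sum.mono_neutral_right) (use \<open>finite G\<close> center in auto)
  also have "\<dots> = A (\<lambda>_. m)" by simp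
  also have "A (\<lambda>_. m) = of_real ((real ((2 * m) choose m) / 4 ^ m) ^ CARD('s))"
    by (simp add: A_def \<beta>_def)
  finally show ?thesis by (simp only: expand)
qed

lemma one_plus_cos_nonneg: "0 \<le> 1 + cos (t :: real)"
  using cos_ge_minus_one[of t] by linarith

text \<open>
  The upper bound on \<open>\<bar>t\<bar>\<close> keeps \<open>t\<close> away from the peaks at \<open>1\<close> and \<open>-1\<close>.
\<close>

lemma cos_bump_le_off_center:
  assumes "0 < \<delta>" "\<delta> \<le> \<bar>t\<bar>" "\<bar>t\<bar> \<le> 1 - \<delta>"
  shows "cos_bump m t \<le> ((1 + cos (2 * pi * \<delta>)) / 2) ^ m"
proof -
  have "cos (2 * pi * \<bar>t\<bar>) \<le> cos (2 * pi * \<delta>)"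
  proof (cases "\<bar>t\<bar> \<le> 1 / 2")
    case True
    then show ?thesis using assms by (intro cos_monotone_0_pi_le) auto
  next
    case False
    have "cos (2 * pi * \<bar>t\<bar>) = cos (2 * pi * (1 - \<bar>t\<bar>))"
      using cos_2pi_minus[of "2 * pi * \<bar>t\<bar>"] by (simp add: algebra_simps)
    also have "\<dots> \<le> cos (2 * pi * \<delta>)"
      using assms False by (intro cos_monotone_0_pi_le) auto
    finally show ?thesis .
  qed
  moreover have "cos (2 * pi * \<bar>t\<bar>) = cos (2 * pi * t)"
    by (cases "t \<ge> 0") auto
  ultimately show ?thesis
    unfolding cos_bump_def using one_plus_cos_nonneg[of "2 * pi * t"]
    by (intro power_mono divide_right_mono) auto
qed

lemma cos_bump_nonneg: "0 \<le> cos_bump m t"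
  unfolding cos_bump_def using one_plus_cos_nonneg[of "2 * pi * t"] by (intro zero_le_power) simp

lemma cos_bump_le_1: "cos_bump m t \<le> 1"
  unfolding cos_bump_def using one_plus_cos_nonneg[of "2 * pi * t"] cos_le_one[of "2 * pi * t"]
  by (intro power_le_one) auto

lemma cos_bump_frac: "cos_bump m (frac y - t) = cos_bump m (y - t)"
proof -
  have "cos (2 * pi * (frac y - t)) = cos (2 * pi * (y - t))"
    using cos.plus_of_int[of "2 * pi * (frac y - t)" "floor y"]
    by (simp add: frac_def algebra_simps)
  then show ?thesis by (simp add: cos_bump_def)
qed

text \<open>
  The central binomial coefficient is at least \<open>4^m / (2 m)\<close>, so the right-hand side decays at most
  polynomially in \<open>m\<close>.  Taking an \<open>s\<close>-th root of \<open>\<rho>\<close> reduces the comparison to the limit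
  \<open>m r^m \<longlonglongrightarrow> 0\<close>.
\<close>

lemma power_less_central_binomial_mean:
  fixes \<rho> :: real
  assumes "0 \<le> \<rho>" "\<rho> < 1" "s > 0"
  obtains m where "\<rho> ^ m < (real ((2 * m) choose m) / 4 ^ m) ^ s"
proof -
  define r where "r = root s \<rho>"
  have r: "0 \<le> r" "r < 1" using assms by (auto simp: r_def)
  have rs: "\<rho> = r ^ s" using assms by (simp add: r_def)
  have "(\<lambda>m. real m * r ^ m) \<longlonglongrightarrow> 0"
    using powser_times_n_limit_0[of r] r by simp
  then have "\<forall>\<^sub>F m in sequentially. real m * r ^ m < 1 / 2"
    by (rule order_tendstoD) simp
  moreover have "\<forall>\<^sub>F m in sequentially. m > 0" by (rule eventually_gt_at_top)
  ultimately have "\<forall>\<^sub>F m in sequentially. m > 0 \<and> real m * r ^ m < 1 / 2"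
    by eventually_elim simp
  then obtain m where m: "m > 0" "real m * r ^ m < 1 / 2"
    by (auto simp: eventually_sequentially)
  have "r ^ m < 1 / (2 * real m)" using m by (simp add: field_simps)
  also have "\<dots> \<le> real ((2 * m) choose m) / 4 ^ m"
    using central_binomial_lower_bound[OF m(1)] m(1) by (simp add: field_simps)
  finally have "(r ^ m) ^ s < (real ((2 * m) choose m) / 4 ^ m) ^ s"
    using r assms by (intro power_strict_mono) auto
  then show ?thesis using that rs by (simp add: power_mult[symmetric] mult.commute)
qed

section \<open>Visits to boxes\<close>

text \<open>
  Choose \<open>N\<close> so large that over every window of length \<open>N\<close> the product of bumps centred in the box
  has an average within \<open>\<epsilon> = (\<mu> - \<rho>^m) / 2\<close> of its mean \<open>\<mu>\<close>, where \<open>\<mu> > \<rho>^m\<close>.  A window that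
  missed the box would have an average of at most \<open>\<rho>^m\<close>.
\<close>

lemma box_visited_with_bounded_gaps:
  fixes x :: "nat \<Rightarrow> real ^ 's" and a b :: "real ^ 's"
  assumes Weyl: "\<And>h :: int ^ 's. h \<noteq> 0 \<Longrightarrow>
      has_uniform_mean (\<lambda>n. cis (2 * pi * (\<Sum>i\<in>UNIV. real_of_int (h $ i) * x n $ i))) 0"
    and ab: "\<And>i. a $ i < b $ i" "\<And>i. 0 \<le> a $ i" "\<And>i. b $ i \<le> 1"
  shows "\<exists>K. \<forall>n. \<exists>j<K. frac_vec (x (n + j)) \<in> half_open_box a b"
proof -
  define c where "c = (\<chi> i. (a $ i + b $ i) / 2)"
  define \<delta> where "\<delta> = Min (range (\<lambda>i. (b $ i - a $ i) / 2))"
  have \<delta>_le: "\<delta> \<le> (b $ i - a $ i) / 2" for i unfolding \<delta>_def by (intro Min_le) auto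
  have "\<delta> > 0" unfolding \<delta>_def using ab(1) by (subst Min_gr_iff) auto
  have "\<delta> \<le> 1 / 2"
  proof -
    fix i :: 's
    show "\<delta> \<le> 1 / 2" using \<delta>_le[of i] ab(2)[of i] ab(3)[of i] by argo
  qed
  define \<rho> where "\<rho> = (1 + cos (2 * pi * \<delta>)) / 2"
  have "0 \<le> \<rho>" using one_plus_cos_nonneg[of "2 * pi * \<delta>"] by (simp add: \<rho>_def)
  have "cos (2 * pi * \<delta>) < cos 0"
    using \<open>\<delta> > 0\<close> \<open>\<delta> \<le> 1 / 2\<close> by (intro cos_monotone_0_pi) auto
  then have "\<rho> < 1" by (simp add: \<rho>_def)
  obtain m where m: "\<rho> ^ m < (real ((2 * m) choose m) / 4 ^ m) ^ CARD('s)"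
    using power_less_central_binomial_mean[OF \<open>0 \<le> \<rho>\<close> \<open>\<rho> < 1\<close>, of "CARD('s)"] by auto
  define \<mu> where "\<mu> = (real ((2 * m) choose m) / 4 ^ m) ^ CARD('s)"
  define T where "T n = (\<Prod>i\<in>UNIV. cos_bump m (x n $ i - c $ i))" for n
  have outside: "T n \<le> \<rho> ^ m" if "frac_vec (x n) \<notin> half_open_box a b" for n
  proof -
    obtain i where i: "\<not> (a $ i \<le> frac (x n $ i) \<and> frac (x n $ i) < b $ i)"
      using \<open>frac_vec (x n) \<notin> half_open_box a b\<close> by (auto simp: half_open_box_def frac_vec_def)
    (* The box does not cross the boundary of the unit cube, so the i-th coordinate keeps the
       distance \<delta> from c_i also modulo 1. *)
    define t where "t = frac (x n $ i) - c $ i"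
    have "\<delta> \<le> \<bar>t\<bar>" using i \<delta>_le[of i] by (auto simp: t_def c_def field_simps)
    moreover have "\<bar>t\<bar> \<le> 1 - \<delta>"
    proof -
      have "\<delta> \<le> c $ i" "c $ i \<le> 1 - \<delta>"
        using \<delta>_le[of i] ab(2)[of i] ab(3)[of i] by (simp_all add: c_def field_simps)
      then show ?thesis
        using frac_ge_0[of "x n $ i"] frac_lt_1[of "x n $ i"]
        unfolding t_def abs_le_iff by linarith
    qed
    ultimately have "cos_bump m (x n $ i - c $ i) \<le> \<rho> ^ m"
      using cos_bump_le_off_center[OF \<open>\<delta> > 0\<close>, of t m] by (simp add: t_def \<rho>_def cos_bump_frac)
    moreover have "T n = cos_bump m (x n $ i - c $ i) * (\<Prod>i\<in>UNIV - {i}. cos_bump m (x n $ i - c $ i))"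
      unfolding T_def by (rule prod.remove) auto
    moreover have "\<dots> \<le> cos_bump m (x n $ i - c $ i) * 1"
      by (intro mult_left_mono prod_le_1) (auto simp: cos_bump_nonneg cos_bump_le_1)
    ultimately show ?thesis by simp
  qed
  define \<epsilon> where "\<epsilon> = (\<mu> - \<rho> ^ m) / 2"
  have "\<epsilon> > 0" using m by (simp add: \<epsilon>_def \<mu>_def)
  have "has_uniform_mean (\<lambda>n. of_real (T n)) (of_real \<mu>)"
    unfolding T_def \<mu>_def by (rule uniform_mean_cos_bump_product[OF Weyl])
  then have "\<forall>\<^sub>F N in sequentially. \<forall>n. norm ((\<Sum>j<N. complex_of_real (T (n + j))) - of_nat N * of_real \<mu>) \<le> \<epsilon> * real N"
    using \<open>\<epsilon> > 0\<close> by (simp add: has_uniform_mean_def)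
  moreover have "\<forall>\<^sub>F N :: nat in sequentially. N > 0" by (rule eventually_gt_at_top)
  ultimately have "\<forall>\<^sub>F N in sequentially. N > 0 \<and>
      (\<forall>n. norm ((\<Sum>j<N. complex_of_real (T (n + j))) - of_nat N * of_real \<mu>) \<le> \<epsilon> * real N)"
    by eventually_elim simp
  then obtain N where "N > 0"
    and N: "\<And>n. norm ((\<Sum>j<N. complex_of_real (T (n + j))) - of_nat N * of_real \<mu>) \<le> \<epsilon> * real N"
    by (auto simp: eventually_sequentially)
  have "\<exists>j<N. frac_vec (x (n + j)) \<in> half_open_box a b" for n
  proof (rule ccontr)
    assume "\<not> ?thesis"
    then have "(\<Sum>j<N. T (n + j)) \<le> (\<Sum>j<N. \<rho> ^ m)"
      by (intro sum_mono outside) auto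
    moreover have "\<bar>(\<Sum>j<N. T (n + j)) - real N * \<mu>\<bar> \<le> \<epsilon> * real N"
    proof -
      have "(\<Sum>j<N. complex_of_real (T (n + j))) - of_nat N * of_real \<mu>
          = of_real ((\<Sum>j<N. T (n + j)) - real N * \<mu>)" by simp
      then show ?thesis using N[of n] by (simp only: norm_of_real)
    qed
    ultimately have "real N * \<mu> - real N * \<rho> ^ m \<le> \<epsilon> * real N" by simp
    moreover have "real N * \<mu> - real N * \<rho> ^ m = 2 * (\<epsilon> * real N)"
      by (simp add: \<epsilon>_def field_simps)
    moreover have "0 < \<epsilon> * real N" using \<open>N > 0\<close> \<open>\<epsilon> > 0\<close> by simp
    ultimately show False by linarith
  qed
  then show ?thesis by blast
qed

lemma unit_cube_iff: "x \<in> unit_cube \<longleftrightarrow> (\<forall>i. 0 \<le> x $ i \<and> x $ i < 1)"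
  by (simp add: unit_cube_def half_open_box_def)

lemma half_open_box_subset_unit_cube_bounds:
  fixes a b :: "real ^ 's"
  assumes lt: "\<And>i. a $ i < b $ i" and sub: "half_open_box a b \<subseteq> unit_cube"
  shows "0 \<le> a $ i" "b $ i \<le> 1"
proof -
  have "a \<in> half_open_box a b" using lt by (simp add: half_open_box_def)
  with sub show "0 \<le> a $ i" by (auto simp: unit_cube_iff)
  (* The box is open at b; a point of it has its i-th coordinate just below b_i instead. *)
  show "b $ i \<le> 1"
  proof (rule dense_le_bounded[OF lt[of i]])
    fix t assume "a $ i < t" "t < b $ i"
    then have "(\<chi> j. if j = i then t else a $ j) \<in> half_open_box a b"
      using lt by (simp add: half_open_box_def)
    with sub have "(\<chi> j. if j = i then t else a $ j) \<in> unit_cube" by blast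
    then have "(\<chi> j. if j = i then t else a $ j) $ i < 1" unfolding unit_cube_iff by blast
    then show "t \<le> 1" by simp
  qed
qed

text \<open>
  Some side of the box is shorter than 1, and a slab of the cube across the uncovered part of that
  side does not meet the box.
\<close>

lemma complement_contains_box:
  fixes a b :: "real ^ 's"
  assumes lt: "\<And>i. a $ i < b $ i" and sub: "half_open_box a b \<subseteq> unit_cube"
    and ne: "half_open_box a b \<noteq> unit_cube"
  obtains a' b' :: "real ^ 's"
  where "\<And>i. a' $ i < b' $ i" "\<And>i. 0 \<le> a' $ i" "\<And>i. b' $ i \<le> 1"
    "half_open_box a' b' \<inter> half_open_box a b = {}"
proof -
  note bounds = half_open_box_subset_unit_cube_bounds[OF lt sub]
  obtain i where i: "a $ i > 0 \<or> b $ i < 1"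
  proof (rule ccontr)
    assume "\<not> thesis"
    then have "\<not> (a $ i > 0 \<or> b $ i < 1)" for i using that by blast
    then have "a $ i = 0" "b $ i = 1" for i using bounds[of i] by (auto simp: not_less intro: antisym)
    with ne show False by (simp add: unit_cube_def half_open_box_def)
  qed
  define l u where "l = (if a $ i > 0 then 0 else b $ i)" and "u = (if a $ i > 0 then a $ i else 1)"
  have lu: "l < u" "0 \<le> l" "u \<le> 1" "{l..<u} \<inter> {a $ i..<b $ i} = {}"
    using i bounds[of i] lt[of i] by (auto simp: l_def u_def)
  show ?thesis
  proof (rule that[of "\<chi> j. if j = i then l else 0" "\<chi> j. if j = i then u else 1"])
    show "half_open_box (\<chi> j. if j = i then l else 0) (\<chi> j. if j = i then u else 1) \<inter> half_open_box a b = {}"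
    proof (rule equals0I)
      fix x assume x: "x \<in> half_open_box (\<chi> j. if j = i then l else 0) (\<chi> j. if j = i then u else 1) \<inter> half_open_box a b"
      then have "(if i = i then l else 0) \<le> x $ i \<and> x $ i < (if i = i then u else 1)"
        unfolding half_open_box_def Int_iff mem_Collect_eq vec_lambda_beta by blast
      moreover have "a $ i \<le> x $ i \<and> x $ i < b $ i"
        using x by (simp add: half_open_box_def)
      ultimately have "x $ i \<in> {l..<u} \<inter> {a $ i..<b $ i}" by simp
      with lu(4) show False by simp
    qed
  qed (use lu in auto)
qed

theorem theorem2:
  fixes p :: "real poly ^ 's"
  assumes "\<And>h :: int ^ 's. h \<noteq> 0 \<Longrightarrow> \<exists>k\<ge>1. coeff (inner_poly h p) k \<notin> \<rat>"
  shows "\<not> (\<exists>a b. S_NBRS (\<lambda>n. frac_vec (eval_poly_vec p (real n))) a b)"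
proof
  assume "\<exists>a b. S_NBRS (\<lambda>n. frac_vec (eval_poly_vec p (real n))) a b"
  then obtain a b where nbrs: "S_NBRS (\<lambda>n. frac_vec (eval_poly_vec p (real n))) a b" by blast
  then have lt: "\<And>i. a $ i < b $ i" and sub: "half_open_box a b \<subseteq> unit_cube"
    and ne: "half_open_box a b \<noteq> unit_cube"
    by (auto simp: S_NBRS_def)
  note visited = box_visited_with_bounded_gaps[where x = "\<lambda>n. eval_poly_vec p (real n)",
      OF Weyl_uniform_inner[OF assms]]
  obtain a' b' :: "real ^ 's" where box': "\<And>i. a' $ i < b' $ i" "\<And>i. 0 \<le> a' $ i" "\<And>i. b' $ i \<le> 1"
    and disj: "half_open_box a' b' \<inter> half_open_box a b = {}"
    using complement_contains_box[OF lt sub ne] by metis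
  obtain K where K: "\<And>n. \<exists>j<K. frac_vec (eval_poly_vec p (real (n + j))) \<in> half_open_box a b"
    using visited[of a b] lt half_open_box_subset_unit_cube_bounds[OF lt sub] by blast
  obtain K' where K': "\<And>n. \<exists>j<K'. frac_vec (eval_poly_vec p (real (n + j))) \<in> half_open_box a' b'"
    using visited[of a' b'] box' by blast
  have "max K K' \<ge> 1" using K[of 0] by auto
  then obtain n where "(\<forall>j<max K K'. frac_vec (eval_poly_vec p (real (n + j))) \<in> half_open_box a b) \<or>
      (\<forall>j<max K K'. frac_vec (eval_poly_vec p (real (n + j))) \<notin> half_open_box a b)"
    using nbrs unfolding S_NBRS_def by blast
  then show False
    using K[of n] K'[of n] disj by (meson disjoint_iff less_max_iff_disj)
qed

end
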